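(* Let $a_0,\dots,a_7$ be real numbers. An Einstein (semi-Riemannian) manifold is $(R,S_{\mathcal{T}_a})$-semisymmetric.
   Context: Let $(M,g)$ be an $n$-dimensional semi-Riemannian manifold with curvature tensor $R$, Ricci tensor $S$ (with $S(Y,Z)$ the trace of $X\mapsto R(X,Y)Z$), Ricci operator $Q$ ($g(QX,Y)=S(X,Y)$) and scalar curvature $r$. For real numbers $a_0,\dots,a_7$, the $\mathcal{T}_a$-curvature tensor is $$\mathcal{T}_a(X,Y)Z=a_0R(X,Y)Z+a_1S(Y,Z)X+a_2S(X,Z)Y+a_3S(X,Y)Z+a_4g(Y,Z)QX+a_5g(X,Z)QY+a_6g(X,Y)QZ+a_7r\,(g(Y,Z)X-g(X,Z)Y),$$ and its Ricci-type contraction is $$S_{\mathcal{T}_a}(X,Y)=(a_0+na_1+a_2+a_3+a_5+a_6)S(X,Y)+(a_4+(n-1)a_7)r\,g(X,Y).$$ $M$ is Einstein if $S=d_1g$ for a smooth function $d_1$ on $M$. $M$ is $(R,S_{\mathcal{T}_a})$-semisymmetric if $R(X,Y)\cdot S_{\mathcal{T}_a}=0$ for all $X,Y$, i.e. $S_{\mathcal{T}_a}(R(X,Y)U,V)+S_{\mathcal{T}_a}(U,R(X,Y)V)=0$ for all $X,Y,U,V$. *)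

theory Defs
  imports "HOL-Analysis.Analysis" "HOL-Library.Function_Algebras"
begin

instantiation "fun" :: (type, real_vector) real_vector
begin

definition scaleR_fun :: "real \<Rightarrow> ('a \<Rightarrow> 'b) \<Rightarrow> 'a \<Rightarrow> 'b"
  where "scaleR_fun c f = (\<lambda>x. c *\<^sub>R f x)"

instance
  by standard (auto simp: scaleR_fun_def fun_eq_iff scaleR_add_right scaleR_add_left)

end

section \<open>Smooth manifolds\<close>

(* C^k on an open set U of a Euclidean space: all iterated partial derivatives up to order k
   exist and are continuous.  Only used for open U. *)
primrec Ck_on :: "nat \<Rightarrow> 'e set \<Rightarrow> ('e::euclidean_space \<Rightarrow> 'f::real_normed_vector) \<Rightarrow> bool" where
  "Ck_on 0 U f \<longleftrightarrow> continuous_on U f"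
| "Ck_on (Suc k) U f \<longleftrightarrow>
     f differentiable_on U \<and> (\<forall>b\<in>Basis. Ck_on k U (\<lambda>x. frechet_derivative f (at x) b))"

definition smooth_on :: "'e set \<Rightarrow> ('e::euclidean_space \<Rightarrow> 'f::real_normed_vector) \<Rightarrow> bool"
  where "smooth_on U f \<longleftrightarrow> (\<forall>k. Ck_on k U f)"

(* The manifold is the whole type 'a with its class topology; a chart is a pair of its domain
   and the chart map.  The dimension of the manifold is DIM('e). *)
type_synonym ('a, 'e) atlas = "('a set \<times> ('a \<Rightarrow> 'e)) set"

(* Hausdorff and second countable are the type class constraints.  The atlas need not be maximal:
   every notion below depends only on the smooth structure that it generates. *)
definition smooth_atlas ::
    "('a::{t2_space, second_countable_topology}, 'e::euclidean_space) atlas \<Rightarrow> bool" where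
  "smooth_atlas A \<longleftrightarrow>
     (\<forall>(U, \<phi>)\<in>A. open U \<and> open (\<phi> ` U) \<and> homeomorphism U (\<phi> ` U) \<phi> (inv_into U \<phi>)) \<and>
     (\<Union>(U, \<phi>)\<in>A. U) = UNIV \<and>
     (\<forall>(U, \<phi>)\<in>A. \<forall>(V, \<psi>)\<in>A. smooth_on (\<phi> ` (U \<inter> V)) (\<psi> \<circ> inv_into U \<phi>))"

definition smooth_functions :: "('a, 'e::euclidean_space) atlas \<Rightarrow> ('a \<Rightarrow> real) set" where
  "smooth_functions A = {f. \<forall>(U, \<phi>)\<in>A. smooth_on (\<phi> ` U) (f \<circ> inv_into U \<phi>)}"

type_synonym 'a tangent = "('a \<Rightarrow> real) \<Rightarrow> real"
type_synonym 'a vfield = "'a \<Rightarrow> 'a tangent"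

(* Tangent vectors at p are the derivations at p of the algebra of smooth functions; the value 0
   outside that algebra makes equality of tangent vectors equality of derivations. *)
definition tangent_space :: "('a, 'e::euclidean_space) atlas \<Rightarrow> 'a \<Rightarrow> 'a tangent set" where
  "tangent_space A p = {v.
     (\<forall>f\<in>smooth_functions A. \<forall>h\<in>smooth_functions A. v (\<lambda>q. f q + h q) = v f + v h) \<and>
     (\<forall>f\<in>smooth_functions A. \<forall>c. v (\<lambda>q. c * f q) = c * v f) \<and>
     (\<forall>f\<in>smooth_functions A. \<forall>h\<in>smooth_functions A.
        v (\<lambda>q. f q * h q) = v f * h p + f p * v h) \<and>
     (\<forall>f. f \<notin> smooth_functions A \<longrightarrow> v f = 0)}"

definition deriv_along :: "'a vfield \<Rightarrow> ('a \<Rightarrow> real) \<Rightarrow> 'a \<Rightarrow> real"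
  where "deriv_along X f = (\<lambda>p. X p f)"

definition vector_fields :: "('a, 'e::euclidean_space) atlas \<Rightarrow> 'a vfield set" where
  "vector_fields A = {X. (\<forall>p. X p \<in> tangent_space A p) \<and>
     (\<forall>f\<in>smooth_functions A. deriv_along X f \<in> smooth_functions A)}"

definition fmult :: "('a \<Rightarrow> real) \<Rightarrow> 'a vfield \<Rightarrow> 'a vfield"
  where "fmult f X = (\<lambda>p. f p *\<^sub>R X p)"

definition lie_bracket :: "'a vfield \<Rightarrow> 'a vfield \<Rightarrow> 'a vfield" where
  "lie_bracket X Y = (\<lambda>p f. X p (deriv_along Y f) - Y p (deriv_along X f))"

section \<open>Semi-Riemannian metrics and the Levi-Civita connection\<close>

type_synonym 'a metric = "'a \<Rightarrow> 'a tangent \<Rightarrow> 'a tangent \<Rightarrow> real"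

definition metric_fun :: "'a metric \<Rightarrow> 'a vfield \<Rightarrow> 'a vfield \<Rightarrow> 'a \<Rightarrow> real"
  where "metric_fun g X Y = (\<lambda>p. g p (X p) (Y p))"

definition metric_index :: "('a, 'e::euclidean_space) atlas \<Rightarrow> 'a metric \<Rightarrow> 'a \<Rightarrow> nat" where
  "metric_index A g p =
     Max {dim W |W. subspace W \<and> W \<subseteq> tangent_space A p \<and> (\<forall>w\<in>W. w \<noteq> 0 \<longrightarrow> g p w w < 0)}"

(* Bilinearity follows from symmetry and linearity in the first argument. *)
definition semi_riemannian_manifold ::
    "('a::{t2_space, second_countable_topology}, 'e::euclidean_space) atlas \<Rightarrow> 'a metric \<Rightarrow> bool" where
  "semi_riemannian_manifold A g \<longleftrightarrow>
     smooth_atlas A \<and>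
     (\<forall>p. \<forall>x\<in>tangent_space A p. \<forall>y\<in>tangent_space A p. g p x y = g p y x) \<and>
     (\<forall>p. \<forall>x\<in>tangent_space A p. \<forall>y\<in>tangent_space A p. \<forall>z\<in>tangent_space A p.
        g p (x + y) z = g p x z + g p y z) \<and>
     (\<forall>p. \<forall>x\<in>tangent_space A p. \<forall>y\<in>tangent_space A p. \<forall>c.
        g p (c *\<^sub>R x) y = c * g p x y) \<and>
     (\<forall>p. \<forall>x\<in>tangent_space A p. (\<forall>y\<in>tangent_space A p. g p x y = 0) \<longrightarrow> x = 0) \<and>
     (\<forall>X\<in>vector_fields A. \<forall>Y\<in>vector_fields A. metric_fun g X Y \<in> smooth_functions A) \<and>
     (\<forall>p q. metric_index A g p = metric_index A g q)"

type_synonym 'a connection = "'a vfield \<Rightarrow> 'a vfield \<Rightarrow> 'a vfield"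

(* nabla X Y is the covariant derivative of Y along X.  On vector fields, these conditions determine
   nabla uniquely, and a nabla satisfying them always exists (fundamental theorem). *)
definition levi_civita_connection ::
    "('a, 'e::euclidean_space) atlas \<Rightarrow> 'a metric \<Rightarrow> 'a connection \<Rightarrow> bool" where
  "levi_civita_connection A g nabla \<longleftrightarrow>
     (\<forall>X\<in>vector_fields A. \<forall>Y\<in>vector_fields A. nabla X Y \<in> vector_fields A) \<and>
     (\<forall>X\<in>vector_fields A. \<forall>X'\<in>vector_fields A. \<forall>Y\<in>vector_fields A.
        nabla (X + X') Y = nabla X Y + nabla X' Y) \<and>
     (\<forall>f\<in>smooth_functions A. \<forall>X\<in>vector_fields A. \<forall>Y\<in>vector_fields A.
        nabla (fmult f X) Y = fmult f (nabla X Y)) \<and>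
     (\<forall>X\<in>vector_fields A. \<forall>Y\<in>vector_fields A. \<forall>Y'\<in>vector_fields A.
        nabla X (Y + Y') = nabla X Y + nabla X Y') \<and>
     (\<forall>f\<in>smooth_functions A. \<forall>X\<in>vector_fields A. \<forall>Y\<in>vector_fields A.
        nabla X (fmult f Y) = fmult (deriv_along X f) Y + fmult f (nabla X Y)) \<and>
     (\<forall>X\<in>vector_fields A. \<forall>Y\<in>vector_fields A.
        nabla X Y - nabla Y X = lie_bracket X Y) \<and>
     (\<forall>X\<in>vector_fields A. \<forall>Y\<in>vector_fields A. \<forall>Z\<in>vector_fields A.
        deriv_along X (metric_fun g Y Z) =
          (\<lambda>p. metric_fun g (nabla X Y) Z p + metric_fun g Y (nabla X Z) p))"

section \<open>Curvature\<close>

definition curvature ::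
    "'a connection \<Rightarrow> 'a vfield \<Rightarrow> 'a vfield \<Rightarrow> 'a vfield \<Rightarrow> 'a vfield" where
  "curvature nabla X Y Z =
     nabla X (nabla Y Z) - nabla Y (nabla X Z) - nabla (lie_bracket X Y) Z"

definition extend_field :: "('a, 'e::euclidean_space) atlas \<Rightarrow> 'a \<Rightarrow> 'a tangent \<Rightarrow> 'a vfield"
  where "extend_field A p v = (SOME X. X \<in> vector_fields A \<and> X p = v)"

(* The curvature tensor on tangent vectors at p.  Since the curvature is a tensor, its value at p
   does not depend on the chosen extensions to vector fields. *)
definition curvature_at ::
    "('a, 'e::euclidean_space) atlas \<Rightarrow> 'a connection \<Rightarrow> 'a
      \<Rightarrow> 'a tangent \<Rightarrow> 'a tangent \<Rightarrow> 'a tangent \<Rightarrow> 'a tangent" where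
  "curvature_at A nabla p x y z =
     curvature nabla (extend_field A p x) (extend_field A p y) (extend_field A p z) p"

(* Trace of an endomorphism of a finite-dimensional subspace V: the sum of the diagonal
   coefficients with respect to a basis of V. *)
definition trace_on :: "'v::real_vector set \<Rightarrow> ('v \<Rightarrow> 'v) \<Rightarrow> real" where
  "trace_on V T = (let B = (SOME B. B \<subseteq> V \<and> independent B \<and> V \<subseteq> span B)
     in \<Sum>b\<in>B. representation B (T b) b)"

definition ricci ::
    "('a, 'e::euclidean_space) atlas \<Rightarrow> 'a connection \<Rightarrow> 'a \<Rightarrow> 'a tangent \<Rightarrow> 'a tangent \<Rightarrow> real" where
  "ricci A nabla p y z = trace_on (tangent_space A p) (\<lambda>x. curvature_at A nabla p x y z)"

definition ricci_operator ::
    "('a, 'e::euclidean_space) atlas \<Rightarrow> 'a metric \<Rightarrow> 'a connection \<Rightarrow> 'a \<Rightarrow> 'a tangent \<Rightarrow> 'a tangent" where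
  "ricci_operator A g nabla p x =
     (THE q. q \<in> tangent_space A p \<and> (\<forall>y\<in>tangent_space A p. g p q y = ricci A nabla p x y))"

definition scalar_curvature ::
    "('a, 'e::euclidean_space) atlas \<Rightarrow> 'a metric \<Rightarrow> 'a connection \<Rightarrow> 'a \<Rightarrow> real" where
  "scalar_curvature A g nabla p = trace_on (tangent_space A p) (ricci_operator A g nabla p)"

definition einstein :: "('a, 'e::euclidean_space) atlas \<Rightarrow> 'a metric \<Rightarrow> 'a connection \<Rightarrow> bool" where
  "einstein A g nabla \<longleftrightarrow> (\<exists>d1\<in>smooth_functions A.
     \<forall>p. \<forall>x\<in>tangent_space A p. \<forall>y\<in>tangent_space A p. ricci A nabla p x y = d1 p * g p x y)"

section \<open>The T-curvature tensor and semisymmetry\<close>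

definition T_curvature_at ::
    "real \<Rightarrow> real \<Rightarrow> real \<Rightarrow> real \<Rightarrow> real \<Rightarrow> real \<Rightarrow> real \<Rightarrow> real
      \<Rightarrow> ('a, 'e::euclidean_space) atlas \<Rightarrow> 'a metric \<Rightarrow> 'a connection
      \<Rightarrow> 'a \<Rightarrow> 'a tangent \<Rightarrow> 'a tangent \<Rightarrow> 'a tangent \<Rightarrow> 'a tangent" where
  "T_curvature_at a0 a1 a2 a3 a4 a5 a6 a7 A g nabla p x y z =
     (let S = ricci A nabla p; Q = ricci_operator A g nabla p; r = scalar_curvature A g nabla p in
      a0 *\<^sub>R curvature_at A nabla p x y z
      + (a1 * S y z) *\<^sub>R x + (a2 * S x z) *\<^sub>R y + (a3 * S x y) *\<^sub>R z
      + (a4 * g p y z) *\<^sub>R Q x + (a5 * g p x z) *\<^sub>R Q y + (a6 * g p x y) *\<^sub>R Q z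
      + (a7 * r) *\<^sub>R (g p y z *\<^sub>R x - g p x z *\<^sub>R y))"

(* The trace of x \<mapsto> T_curvature_at ... p x y z, written out in terms of the Ricci tensor and the
   scalar curvature. *)
definition T_ricci ::
    "real \<Rightarrow> real \<Rightarrow> real \<Rightarrow> real \<Rightarrow> real \<Rightarrow> real \<Rightarrow> real \<Rightarrow> real
      \<Rightarrow> ('a, 'e::euclidean_space) atlas \<Rightarrow> 'a metric \<Rightarrow> 'a connection
      \<Rightarrow> 'a \<Rightarrow> 'a tangent \<Rightarrow> 'a tangent \<Rightarrow> real" where
  "T_ricci a0 a1 a2 a3 a4 a5 a6 a7 A g nabla p x y =
     (let n = real DIM('e) in
      (a0 + n * a1 + a2 + a3 + a5 + a6) * ricci A nabla p x y
      + (a4 + (n - 1) * a7) * scalar_curvature A g nabla p * g p x y)"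

definition semisymmetric ::
    "('a, 'e::euclidean_space) atlas \<Rightarrow> 'a connection
      \<Rightarrow> ('a \<Rightarrow> 'a tangent \<Rightarrow> 'a tangent \<Rightarrow> real) \<Rightarrow> bool" where
  "semisymmetric A nabla B \<longleftrightarrow>
     (\<forall>X\<in>vector_fields A. \<forall>Y\<in>vector_fields A. \<forall>U\<in>vector_fields A. \<forall>V\<in>vector_fields A. \<forall>p.
        B p (curvature nabla X Y U p) (V p) + B p (U p) (curvature nabla X Y V p) = 0)"

end

theory Submission
  imports Defs
begin

text \<open>
  The argument is pointwise. On an Einstein manifold the Ricci tensor is a multiple of the metric at
  each point, hence so is the Ricci-type contraction of the \<open>\<T>\<^sub>a\<close>-curvature tensor, whose
  other summand is a multiple of the metric by definition. What remains is
  \<open>g (R(X,Y)U, V) + g (U, R(X,Y)V) = 0\<close>, the skew-adjointness of the curvature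
  operator of a metric connection (\<open>metric_curvature_skew\<close>). It comes from differentiating the function
  \<open>f = g(U,V)\<close>: metric compatibility expands \<open>X(Yf)\<close> and \<open>Y(Xf)\<close> into four
  terms each, the mixed terms cancel in \<open>X(Yf) - Y(Xf)\<close>, and the result is compared with the
  expansion of \<open>[X,Y]f\<close>. This last expansion needs \<open>[X,Y]\<close> to be a smooth vector field.
  As \<open>[X,Y]\<close> is a difference of two covariant derivatives, this reduces to the closure
  of smooth functions under differences (\<open>smooth_functions_diff\<close>).
\<close>

lemma Ck_on_cong:
  assumes "open U" "\<And>x. x \<in> U \<Longrightarrow> f x = h x" "Ck_on k U f"
  shows "Ck_on k U h"
  using assms(2,3)
proof (induction k arbitrary: f h)
  case 0
  then show ?case
    using continuous_on_cong by fastforce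
next
  case (Suc k)
  have d: "frechet_derivative f (at x) = frechet_derivative h (at x)" if "x \<in> U" for x
    using Suc.prems(1) assms(1) that
    by (intro frechet_derivative_transform_within_open[of f x U])
       (use Suc.prems(2) in \<open>auto simp: differentiable_on_eq_differentiable_at\<close>)
  have "h differentiable_on U"
    using Suc.prems unfolding differentiable_on_def
    by (metis Ck_on.simps(2) differentiable_on_def differentiable_transform_within zero_less_one)
  moreover have "Ck_on k U (\<lambda>x. frechet_derivative h (at x) b)" if "b \<in> Basis" for b
    by (rule Suc.IH[of "\<lambda>x. frechet_derivative f (at x) b"]) (use d that Suc.prems(2) in auto)
  ultimately show ?case
    by simp
qed

lemma Ck_on_diff:
  assumes "open U" "Ck_on k U f" "Ck_on k U h"
  shows "Ck_on k U (\<lambda>x. f x - h x)"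
  using assms(2,3)
proof (induction k arbitrary: f h)
  case 0
  then show ?case
    by (auto intro: continuous_intros)
next
  case (Suc k)
  have "Ck_on k U (\<lambda>x. frechet_derivative (\<lambda>x. f x - h x) (at x) b)" if "b \<in> Basis" for b
  proof (rule Ck_on_cong[OF assms(1)])
    show "Ck_on k U (\<lambda>x. frechet_derivative f (at x) b - frechet_derivative h (at x) b)"
      using Suc that by auto
    show "frechet_derivative f (at x) b - frechet_derivative h (at x) b
        = frechet_derivative (\<lambda>x. f x - h x) (at x) b" if "x \<in> U" for x
    proof -
      have "f differentiable at x" "h differentiable at x"
        using Suc.prems that assms(1) by (auto simp: differentiable_on_eq_differentiable_at)
      then have "((\<lambda>x. f x - h x) has_derivative
          (\<lambda>v. frechet_derivative f (at x) v - frechet_derivative h (at x) v)) (at x)"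
        by (intro has_derivative_diff) (auto simp: frechet_derivative_works)
      from frechet_derivative_at[OF this] show ?thesis
        by metis
    qed
  qed
  then show ?case
    using Suc.prems by (auto intro: differentiable_on_diff)
qed

lemma smooth_functions_diff:
  assumes "smooth_atlas A" "f \<in> smooth_functions A" "h \<in> smooth_functions A"
  shows "(\<lambda>p. f p - h p) \<in> smooth_functions A"
proof -
  have "smooth_on (\<phi> ` U) ((\<lambda>p. f p - h p) \<circ> inv_into U \<phi>)" if "(U, \<phi>) \<in> A" for U \<phi>
  proof -
    have "open (\<phi> ` U)"
      using assms(1) that by (auto simp: smooth_atlas_def)
    moreover have "smooth_on (\<phi> ` U) (f \<circ> inv_into U \<phi>)" "smooth_on (\<phi> ` U) (h \<circ> inv_into U \<phi>)"
      using assms(2,3) that by (auto simp: smooth_functions_def)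
    ultimately show ?thesis
      using Ck_on_diff[of "\<phi> ` U" _ "f \<circ> inv_into U \<phi>" "h \<circ> inv_into U \<phi>"]
      by (simp add: smooth_on_def o_def)
  qed
  then show ?thesis
    by (auto simp: smooth_functions_def)
qed

lemma tangent_space_diff:
  assumes "v \<in> tangent_space A p" "w \<in> tangent_space A p"
  shows "v - w \<in> tangent_space A p"
proof -
  have "a * c + b * d - (a' * c + b * d') = (a - a') * c + b * (d - d')" for a a' b c d d' :: real
    by (simp add: algebra_simps)
  with assms show ?thesis
    unfolding tangent_space_def by (simp add: right_diff_distrib)
qed

lemma vector_fields_diff:
  assumes "smooth_atlas A" "X \<in> vector_fields A" "Y \<in> vector_fields A"
  shows "X - Y \<in> vector_fields A"
proof -
  have "deriv_along (X - Y) f = (\<lambda>p. deriv_along X f p - deriv_along Y f p)" for f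
    by (simp add: deriv_along_def fun_eq_iff)
  with assms show ?thesis
    by (simp add: vector_fields_def tangent_space_diff smooth_functions_diff)
qed

lemma deriv_along_add:
  assumes "X \<in> vector_fields A" "f \<in> smooth_functions A" "h \<in> smooth_functions A"
  shows "deriv_along X (\<lambda>p. f p + h p) p = deriv_along X f p + deriv_along X h p"
proof -
  have "X p \<in> tangent_space A p"
    using assms(1) by (simp add: vector_fields_def)
  then show ?thesis
    using assms(2,3) unfolding tangent_space_def deriv_along_def by blast
qed

lemma metric_diff_left:
  assumes "semi_riemannian_manifold A g"
    and x: "x \<in> tangent_space A p" and y: "y \<in> tangent_space A p" and z: "z \<in> tangent_space A p"
  shows "g p (x - y) z = g p x z - g p y z"
proof -
  have "\<forall>p. \<forall>x\<in>tangent_space A p. \<forall>y\<in>tangent_space A p. \<forall>z\<in>tangent_space A p.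
      g p (x + y) z = g p x z + g p y z"
    using assms(1) unfolding semi_riemannian_manifold_def by (elim conjE)
  from this[rule_format, OF tangent_space_diff[OF x y] y z]
  have "g p ((x - y) + y) z = g p (x - y) z + g p y z" .
  then show ?thesis
    by simp
qed

lemma metric_diff_right:
  assumes "semi_riemannian_manifold A g"
    and "x \<in> tangent_space A p" "y \<in> tangent_space A p" "z \<in> tangent_space A p"
  shows "g p z (x - y) = g p z x - g p z y"
proof -
  have "\<forall>p. \<forall>x\<in>tangent_space A p. \<forall>y\<in>tangent_space A p. g p x y = g p y x"
    using assms(1) unfolding semi_riemannian_manifold_def by (elim conjE)
  then have sym: "g p z u = g p u z" if "u \<in> tangent_space A p" for u
    using that assms(4) by blast
  show ?thesis
    using metric_diff_left[OF assms] assms(2,3) by (simp add: sym tangent_space_diff)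
qed

lemma nabla_in_vector_fields:
  assumes "levi_civita_connection A g nabla" "X \<in> vector_fields A" "Y \<in> vector_fields A"
  shows "nabla X Y \<in> vector_fields A"
  using assms unfolding levi_civita_connection_def by blast

text \<open>The proof uses the torsion-free condition in place of a direct verification of the Leibniz
  rule for the bracket.\<close>

lemma lie_bracket_in_vector_fields:
  assumes "smooth_atlas A" "levi_civita_connection A g nabla"
    and XY: "X \<in> vector_fields A" "Y \<in> vector_fields A"
  shows "lie_bracket X Y \<in> vector_fields A"
proof -
  have "nabla X Y - nabla Y X = lie_bracket X Y"
    using assms(2) XY unfolding levi_civita_connection_def by blast
  moreover have "nabla X Y - nabla Y X \<in> vector_fields A"
    by (intro vector_fields_diff nabla_in_vector_fields[OF assms(2)] assms(1) XY)
  ultimately show ?thesis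
    by simp
qed

lemma curvature_in_vector_fields:
  assumes "smooth_atlas A" "levi_civita_connection A g nabla"
    and "X \<in> vector_fields A" "Y \<in> vector_fields A" "U \<in> vector_fields A"
  shows "curvature nabla X Y U \<in> vector_fields A"
  unfolding curvature_def
  by (intro vector_fields_diff nabla_in_vector_fields[OF assms(2)]
      lie_bracket_in_vector_fields[OF assms(1,2)] assms)

lemma metric_curvature_skew:
  assumes M: "semi_riemannian_manifold A g" and LC: "levi_civita_connection A g nabla"
    and X: "X \<in> vector_fields A" and Y: "Y \<in> vector_fields A"
    and U: "U \<in> vector_fields A" and V: "V \<in> vector_fields A"
  shows "g p (curvature nabla X Y U p) (V p) + g p (U p) (curvature nabla X Y V p) = 0"
proof -
  have atlas: "smooth_atlas A"
    using M unfolding semi_riemannian_manifold_def by blast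
  have L: "lie_bracket X Y \<in> vector_fields A"
    by (rule lie_bracket_in_vector_fields[OF atlas LC X Y])
  note nabla = nabla_in_vector_fields[OF LC]
  have tangent: "Z q \<in> tangent_space A q" if "Z \<in> vector_fields A" for Z q
    using that by (auto simp: vector_fields_def)
  have smooth: "metric_fun g W Z \<in> smooth_functions A"
    if "W \<in> vector_fields A" "Z \<in> vector_fields A" for W Z
    using M that unfolding semi_riemannian_manifold_def by blast
  have compat: "deriv_along W (metric_fun g Z Z') =
      (\<lambda>q. metric_fun g (nabla W Z) Z' q + metric_fun g Z (nabla W Z') q)"
    if "W \<in> vector_fields A" "Z \<in> vector_fields A" "Z' \<in> vector_fields A" for W Z Z'
    using LC that unfolding levi_civita_connection_def by blast
  have second: "deriv_along W (deriv_along Z (metric_fun g U V)) p =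
      g p (nabla W (nabla Z U) p) (V p) + g p (nabla Z U p) (nabla W V p)
      + (g p (nabla W U p) (nabla Z V p) + g p (U p) (nabla W (nabla Z V) p))"
    if "W \<in> vector_fields A" "Z \<in> vector_fields A" for W Z
  proof -
    have "deriv_along W (deriv_along Z (metric_fun g U V)) p =
        deriv_along W (metric_fun g (nabla Z U) V) p + deriv_along W (metric_fun g U (nabla Z V)) p"
      using that U V by (simp add: compat deriv_along_add[of W A] smooth nabla)
    also have "\<dots> = metric_fun g (nabla W (nabla Z U)) V p + metric_fun g (nabla Z U) (nabla W V) p
        + (metric_fun g (nabla W U) (nabla Z V) p + metric_fun g U (nabla W (nabla Z V)) p)"
      using that U V by (simp add: compat nabla)
    finally show ?thesis
      by (simp add: metric_fun_def)
  qed
  have "deriv_along (lie_bracket X Y) (metric_fun g U V) p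
      = deriv_along X (deriv_along Y (metric_fun g U V)) p
        - deriv_along Y (deriv_along X (metric_fun g U V)) p"
    by (simp add: deriv_along_def lie_bracket_def)
  moreover have "deriv_along (lie_bracket X Y) (metric_fun g U V) p
      = g p (nabla (lie_bracket X Y) U p) (V p) + g p (U p) (nabla (lie_bracket X Y) V p)"
    using compat[OF L U V] by (simp add: metric_fun_def)
  moreover have "g p (curvature nabla X Y U p) (V p) =
      g p (nabla X (nabla Y U) p) (V p) - g p (nabla Y (nabla X U) p) (V p)
      - g p (nabla (lie_bracket X Y) U p) (V p)"
    by (simp add: curvature_def metric_diff_left[OF M] tangent_space_diff tangent nabla L X Y U V)
  moreover have "g p (U p) (curvature nabla X Y V p) =
      g p (U p) (nabla X (nabla Y V) p) - g p (U p) (nabla Y (nabla X V) p)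
      - g p (U p) (nabla (lie_bracket X Y) V p)"
    by (simp add: curvature_def metric_diff_right[OF M] tangent_space_diff tangent nabla L X Y U V)
  ultimately show ?thesis
    using second[OF X Y] second[OF Y X] by simp
qed

theorem theorem7p4:
  fixes A :: "('a::{t2_space, second_countable_topology}, 'e::euclidean_space) atlas"
    and g :: "'a metric" and nabla :: "'a connection"
    and a0 a1 a2 a3 a4 a5 a6 a7 :: real
  assumes "semi_riemannian_manifold A g"
    and "levi_civita_connection A g nabla"
    and "einstein A g nabla"
  shows "semisymmetric A nabla (T_ricci a0 a1 a2 a3 a4 a5 a6 a7 A g nabla)"
proof -
  let ?B = "T_ricci a0 a1 a2 a3 a4 a5 a6 a7 A g nabla"
  obtain d where d: "\<And>p x y. x \<in> tangent_space A p \<Longrightarrow> y \<in> tangent_space A p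
      \<Longrightarrow> ricci A nabla p x y = d p * g p x y"
    using assms(3) unfolding einstein_def by blast
  define c where "c p = (a0 + real DIM('e) * a1 + a2 + a3 + a5 + a6) * d p
      + (a4 + (real DIM('e) - 1) * a7) * scalar_curvature A g nabla p" for p
  have B: "?B p x y = c p * g p x y" if "x \<in> tangent_space A p" "y \<in> tangent_space A p" for p x y
    using d[OF that] by (simp add: T_ricci_def Let_def c_def algebra_simps)
  have atlas: "smooth_atlas A"
    using assms(1) unfolding semi_riemannian_manifold_def by blast
  have "?B p (curvature nabla X Y U p) (V p) + ?B p (U p) (curvature nabla X Y V p) = 0"
    if F: "X \<in> vector_fields A" "Y \<in> vector_fields A" "U \<in> vector_fields A" "V \<in> vector_fields A"
    for X Y U V p
  proof -
    have "U p \<in> tangent_space A p" "V p \<in> tangent_space A p"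
      using F by (auto simp: vector_fields_def)
    moreover have "curvature nabla X Y U p \<in> tangent_space A p"
        "curvature nabla X Y V p \<in> tangent_space A p"
      using curvature_in_vector_fields[OF atlas assms(2)] F by (auto simp: vector_fields_def)
    ultimately have "?B p (curvature nabla X Y U p) (V p) + ?B p (U p) (curvature nabla X Y V p)
        = c p * (g p (curvature nabla X Y U p) (V p) + g p (U p) (curvature nabla X Y V p))"
      by (simp add: B distrib_left)
    then show ?thesis
      using metric_curvature_skew[OF assms(1,2) F] by simp
  qed
  then show ?thesis
    unfolding semisymmetric_def by blast
qed

end
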